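(* Let $\Psi=(E,\Delta)$ and $\Psi'=(E',\Delta')$ be ordered simplicial complexes in the class QE, and let $B_0$ be the lexicographically smallest basis of $\Psi$. (i) If $s(E,E')$ is a shuffle of $E$ and $E'$, then the join $\Psi*_{s(E,E')}\Psi'$ is in QE. (ii) If $U\subseteq E$ is any subset such that $\Psi|_U$ is pure and of the same rank as $\Psi$, then the restriction $\Psi|_U$ is in QE. (iii) If $A\subseteq E$ contains $B_0$ and all the elements of $E$ smaller than the largest non-coloop of $B_0$, then the restriction $\Psi|_A$ is in QE. (iv) If $v$ is a vertex of $\Psi$, then the contraction of $v$ in $\Psi$ is in QE. In particular, QE is a quasi-matroidal class and it is a subclass of PURE.
   Context: An ordered simplicial complex is a pair $\Psi=(E,\Delta)$ with $E$ a finite totally ordered set and $\Delta\subseteq 2^E$ a simplicial complex (closed under taking subsets, $\emptyset\in\Delta$). Elements of $\Delta$ are independent sets; inclusion-maximal ones are bases. $\Psi$ is pure if all bases have the same cardinality; its rank is the maximal cardinality of an independent set. A loop is an element of $E$ in no basis; a vertex is an element of $E$ that is not a loop; a coloop is an element lying in every basis. The lexicographic order on subsets of $E$ is the dictionary order on increasingly sorted lists. Restriction: $\Psi|_A=(A,\{I\in\Delta: I\subseteq A\})$. Deletion of a non-coloop $e$: restriction to $E\setminus\{e\}$. Contraction of an independent set $I$: the ordered complex on $E\setminus I$ with independent sets $\{J\subseteq E\setminus I: J\cup I\in\Delta\}$; contraction of a vertex $v$ is contraction of $\{v\}$. A shuffle $s(E,E')$ is a totally ordered set with order-preserving injections $j:E\to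 s(E,E')$, $j':E'\to s(E,E')$ whose images are disjoint and cover $s(E,E')$. The join $\Psi*_{s(E,E')}\Psi'$ has ground set $s(E,E')$ and independent sets $j(I)\cup j'(I')$ with $I\in\Delta$, $I'\in\Delta'$. QE: the class of $\Psi$ that are pure and such that for all bases $B_1,B_2$ and $b_1\in B_1\setminus B_2$ with $b_1>\max(B_2\setminus B_1)$, there is $b_2\in B_2\setminus B_1$ with $(B_1\setminus\{b_1\})\cup\{b_2\}\in\Delta$. PURE: the class of pure ordered complexes defined recursively: $\Psi$ is in PURE iff either $\Psi$ has exactly one basis, or, with $v$ the largest non-coloop vertex of $\Psi$, the deletion of $v$ is in PURE and has the same rank as $\Psi$, and every contraction of $\Psi$ (by a nonempty independent set) is in PURE. An ordered matroid is an ordered complex $(E,\Delta)$ with $\Delta$ the independence complex of a matroid on $E$. $\Psi$ is shifted if whenever $B$ is a basis and $i<j$ in $E$ satisfy $i\notin B$, $j\in B$, then $(B\setminus\{j\})\cup\{i\}$ is a basis. A class $\mathcal A$ of ordered complexes is quasi-matroidal if: (1) every ordered matroid is in $\mathcal A$; (2) if $\Delta$ is a simplicial complex with vertex set $X$ such that $(E,\Delta)\in\mathcal A$ for every total ordering $E$ of $X$, then $\Delta$ is a matroid independence complex; (3) every pure shifted complex is in $\mathcal A$; (4) $\mathcal A$ is closed under joins (for every pair in $\mathcal A$ and every shuffle), under deletions (deleting the largest element of the ground set, when that deletion is defined), and under contractions (of every independent set). *)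

theory Defs
  imports Main
begin

text \<open>
  The order on the ground set is part of the data, as a reflexive relation living on the ground
  set: quasi-matroidality quantifies over all total orderings of one and the same set.
\<close>

record 'a ocomplex =
  ground :: "'a set"
  ord :: "'a rel"
  indep :: "'a set set"

definition abstract_complex :: "'a set \<Rightarrow> 'a set set \<Rightarrow> bool" where
  "abstract_complex E \<Delta> \<longleftrightarrow>
     finite E \<and> \<Delta> \<subseteq> Pow E \<and> {} \<in> \<Delta> \<and> (\<forall>I\<in>\<Delta>. \<forall>J. J \<subseteq> I \<longrightarrow> J \<in> \<Delta>)"

definition ordered_complex :: "'a ocomplex \<Rightarrow> bool" where
  "ordered_complex \<Psi> \<longleftrightarrow>
     abstract_complex (ground \<Psi>) (indep \<Psi>) \<and> linear_order_on (ground \<Psi>) (ord \<Psi>)"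

definition bases :: "'a ocomplex \<Rightarrow> 'a set set" where
  "bases \<Psi> = {B \<in> indep \<Psi>. \<forall>I\<in>indep \<Psi>. B \<subseteq> I \<longrightarrow> I = B}"

definition pure :: "'a ocomplex \<Rightarrow> bool" where
  "pure \<Psi> \<longleftrightarrow> (\<forall>B\<in>bases \<Psi>. \<forall>B'\<in>bases \<Psi>. card B = card B')"

definition complex_rank :: "'a ocomplex \<Rightarrow> nat" where
  "complex_rank \<Psi> = Max (card ` indep \<Psi>)"

definition loops :: "'a ocomplex \<Rightarrow> 'a set" where
  "loops \<Psi> = {e \<in> ground \<Psi>. \<forall>B\<in>bases \<Psi>. e \<notin> B}"

definition vertices :: "'a ocomplex \<Rightarrow> 'a set" where
  "vertices \<Psi> = ground \<Psi> - loops \<Psi>"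

definition coloops :: "'a ocomplex \<Rightarrow> 'a set" where
  "coloops \<Psi> = {e \<in> ground \<Psi>. \<forall>B\<in>bases \<Psi>. e \<in> B}"

definition less_in :: "'a ocomplex \<Rightarrow> 'a \<Rightarrow> 'a \<Rightarrow> bool" where
  "less_in \<Psi> x y \<longleftrightarrow> (x, y) \<in> ord \<Psi> \<and> x \<noteq> y"

text \<open>
  The maximum of a set is treated as a predicate, so that no convention for the maximum of the
  empty set is involved.
\<close>

definition is_max :: "'a ocomplex \<Rightarrow> 'a set \<Rightarrow> 'a \<Rightarrow> bool" where
  "is_max \<Psi> S m \<longleftrightarrow> m \<in> S \<and> (\<forall>x\<in>S. (x, m) \<in> ord \<Psi>)"

definition increasing_list :: "'a ocomplex \<Rightarrow> 'a set \<Rightarrow> 'a list \<Rightarrow> bool" where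
  "increasing_list \<Psi> A xs \<longleftrightarrow> set xs = A \<and> sorted_wrt (less_in \<Psi>) xs"

definition lex_less :: "'a ocomplex \<Rightarrow> 'a set \<Rightarrow> 'a set \<Rightarrow> bool" where
  "lex_less \<Psi> A B \<longleftrightarrow>
     (\<exists>xs ys. increasing_list \<Psi> A xs \<and> increasing_list \<Psi> B ys \<and>
              (xs, ys) \<in> lexord {(x, y). less_in \<Psi> x y})"

definition lex_smallest_basis :: "'a ocomplex \<Rightarrow> 'a set \<Rightarrow> bool" where
  "lex_smallest_basis \<Psi> B \<longleftrightarrow> B \<in> bases \<Psi> \<and> (\<forall>B'\<in>bases \<Psi>. B' \<noteq> B \<longrightarrow> lex_less \<Psi> B B')"

definition restriction :: "'a ocomplex \<Rightarrow> 'a set \<Rightarrow> 'a ocomplex" where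
  "restriction \<Psi> A =
     \<lparr>ground = A, ord = Restr (ord \<Psi>) A, indep = {I \<in> indep \<Psi>. I \<subseteq> A}\<rparr>"

text \<open>Deletion is only meant for elements that are not coloops; uses of it carry that condition.\<close>

definition deletion :: "'a ocomplex \<Rightarrow> 'a \<Rightarrow> 'a ocomplex" where
  "deletion \<Psi> e = restriction \<Psi> (ground \<Psi> - {e})"

definition contraction :: "'a ocomplex \<Rightarrow> 'a set \<Rightarrow> 'a ocomplex" where
  "contraction \<Psi> I =
     \<lparr>ground = ground \<Psi> - I,
      ord = Restr (ord \<Psi>) (ground \<Psi> - I),
      indep = {J. J \<subseteq> ground \<Psi> - I \<and> J \<union> I \<in> indep \<Psi>}\<rparr>"

text \<open>
  A shuffle of two ordered sets \<open>(E, r)\<close> and \<open>(E', r')\<close> is an ordered set \<open>(S, s)\<close> together with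
  the two injections; all three sets may live in different types.
\<close>

definition is_shuffle ::
  "'a set \<Rightarrow> 'a rel \<Rightarrow> 'b set \<Rightarrow> 'b rel \<Rightarrow> 'c set \<Rightarrow> 'c rel \<Rightarrow> ('a \<Rightarrow> 'c) \<Rightarrow> ('b \<Rightarrow> 'c) \<Rightarrow> bool"
where
  "is_shuffle E r E' r' S s j j' \<longleftrightarrow>
     linear_order_on S s \<and>
     inj_on j E \<and> (\<forall>(x, y)\<in>r. (j x, j y) \<in> s) \<and>
     inj_on j' E' \<and> (\<forall>(x, y)\<in>r'. (j' x, j' y) \<in> s) \<and>
     j ` E \<inter> j' ` E' = {} \<and> j ` E \<union> j' ` E' = S"

definition join ::
  "'c set \<Rightarrow> 'c rel \<Rightarrow> ('a \<Rightarrow> 'c) \<Rightarrow> ('b \<Rightarrow> 'c) \<Rightarrow> 'a ocomplex \<Rightarrow> 'b ocomplex \<Rightarrow> 'c ocomplex"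
where
  "join S s j j' \<Psi> \<Psi>' =
     \<lparr>ground = S, ord = s,
      indep = {j ` I \<union> j' ` I' | I I'. I \<in> indep \<Psi> \<and> I' \<in> indep \<Psi>'}\<rparr>"

definition QE :: "'a ocomplex set" where
  "QE = {\<Psi>. ordered_complex \<Psi> \<and> pure \<Psi> \<and>
     (\<forall>B1\<in>bases \<Psi>. \<forall>B2\<in>bases \<Psi>. \<forall>b1\<in>B1 - B2. \<forall>m.
        is_max \<Psi> (B2 - B1) m \<and> less_in \<Psi> m b1 \<longrightarrow>
        (\<exists>b2\<in>B2 - B1. insert b2 (B1 - {b1}) \<in> indep \<Psi>))}"

text \<open>
  The recursion descends along the size of the ground set, so the least fixed point below is the
  only solution of the recursive description.
\<close>

inductive_set PURE :: "'a ocomplex set" where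
  unique_basis:
    "ordered_complex \<Psi> \<Longrightarrow> pure \<Psi> \<Longrightarrow> \<exists>!B. B \<in> bases \<Psi> \<Longrightarrow> \<Psi> \<in> PURE"
| deletion_contraction:
    "ordered_complex \<Psi> \<Longrightarrow> pure \<Psi> \<Longrightarrow>
     is_max \<Psi> (vertices \<Psi> - coloops \<Psi>) v \<Longrightarrow>
     deletion \<Psi> v \<in> PURE \<Longrightarrow>
     complex_rank (deletion \<Psi> v) = complex_rank \<Psi> \<Longrightarrow>
     (\<And>I. I \<in> indep \<Psi> \<Longrightarrow> I \<noteq> {} \<Longrightarrow> contraction \<Psi> I \<in> PURE) \<Longrightarrow>
     \<Psi> \<in> PURE"

definition matroid_complex :: "'a set \<Rightarrow> 'a set set \<Rightarrow> bool" where
  "matroid_complex E \<Delta> \<longleftrightarrow>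
     abstract_complex E \<Delta> \<and>
     (\<forall>I\<in>\<Delta>. \<forall>J\<in>\<Delta>. card I < card J \<longrightarrow> (\<exists>x\<in>J - I. insert x I \<in> \<Delta>))"

definition ordered_matroid :: "'a ocomplex \<Rightarrow> bool" where
  "ordered_matroid \<Psi> \<longleftrightarrow> ordered_complex \<Psi> \<and> matroid_complex (ground \<Psi>) (indep \<Psi>)"

definition shifted :: "'a ocomplex \<Rightarrow> bool" where
  "shifted \<Psi> \<longleftrightarrow>
     (\<forall>B\<in>bases \<Psi>. \<forall>i\<in>ground \<Psi>. \<forall>j\<in>ground \<Psi>.
        less_in \<Psi> i j \<and> i \<notin> B \<and> j \<in> B \<longrightarrow> insert i (B - {j}) \<in> bases \<Psi>)"

text \<open>
  A class of ordered complexes is a set of complexes with ground sets in one type, and the shuffles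
  in the closure under joins are taken in that type; over an infinite type every shuffle
  occurs up to isomorphism. A complex with vertex set \<open>X\<close> has no loops, i.e. \<open>\<Union>\<Delta> = X\<close>.
\<close>

definition quasi_matroidal :: "'a ocomplex set \<Rightarrow> bool" where
  "quasi_matroidal \<A> \<longleftrightarrow>
     (\<forall>\<Psi>\<in>\<A>. ordered_complex \<Psi>) \<and>
     (\<forall>\<Psi>. ordered_matroid \<Psi> \<longrightarrow> \<Psi> \<in> \<A>) \<and>
     (\<forall>X \<Delta>. abstract_complex X \<Delta> \<and> \<Union>\<Delta> = X \<and>
        (\<forall>r. linear_order_on X r \<longrightarrow> \<lparr>ground = X, ord = r, indep = \<Delta>\<rparr> \<in> \<A>) \<longrightarrow>
        matroid_complex X \<Delta>) \<and>
     (\<forall>\<Psi>. ordered_complex \<Psi> \<and> pure \<Psi> \<and> shifted \<Psi> \<longrightarrow> \<Psi> \<in> \<A>) \<and>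
     (\<forall>\<Psi>\<in>\<A>. \<forall>\<Psi>'\<in>\<A>. \<forall>S s j j'.
        is_shuffle (ground \<Psi>) (ord \<Psi>) (ground \<Psi>') (ord \<Psi>') S s j j' \<longrightarrow>
        join S s j j' \<Psi> \<Psi>' \<in> \<A>) \<and>
     (\<forall>\<Psi>\<in>\<A>. \<forall>e. is_max \<Psi> (ground \<Psi>) e \<and> e \<notin> coloops \<Psi> \<longrightarrow> deletion \<Psi> e \<in> \<A>) \<and>
     (\<forall>\<Psi>\<in>\<A>. \<forall>I\<in>indep \<Psi>. contraction \<Psi> I \<in> \<A>)"

end

theory Submission
  imports Defs
begin

text \<open>
  By purity, the exchange condition of \<open>QE\<close> only asks that the element \<open>b1\<close> dominates
  \<open>B2 - B1\<close>. Joins and contractions inherit it because their bases are unions \<open>B \<union> B'\<close> and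
  differences \<open>B - I\<close> of bases. A restriction inherits it as soon as its bases are bases of the
  whole complex; this holds for (iii), and for the deletions required of a quasi-matroidal class and
  of \<open>PURE\<close>, for one reason: if a basis of the restriction were a proper subset of a basis \<open>B\<close>,
  exchanging a large element of \<open>B\<close> outside the restriction for one of a fixed basis inside it
  would enlarge it.
\<close>

section \<open>Bases, rank and maxima of ordered complexes\<close>

lemma indep_subset:
  "ordered_complex \<Psi> \<Longrightarrow> I \<in> indep \<Psi> \<Longrightarrow> J \<subseteq> I \<Longrightarrow> J \<in> indep \<Psi>"
  unfolding ordered_complex_def abstract_complex_def by blast

lemma indep_ground: "ordered_complex \<Psi> \<Longrightarrow> I \<in> indep \<Psi> \<Longrightarrow> I \<subseteq> ground \<Psi>"
  unfolding ordered_complex_def abstract_complex_def by blast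

lemma finite_ground: "ordered_complex \<Psi> \<Longrightarrow> finite (ground \<Psi>)"
  unfolding ordered_complex_def abstract_complex_def by blast

lemma finite_indep: "ordered_complex \<Psi> \<Longrightarrow> finite (indep \<Psi>)"
  unfolding ordered_complex_def abstract_complex_def by (meson finite_Pow_iff finite_subset)

lemma finite_indep_member: "ordered_complex \<Psi> \<Longrightarrow> I \<in> indep \<Psi> \<Longrightarrow> finite I"
  using indep_ground finite_ground finite_subset by blast

lemma bases_indep: "B \<in> bases \<Psi> \<Longrightarrow> B \<in> indep \<Psi>"
  unfolding bases_def by blast

lemma bases_maximal: "B \<in> bases \<Psi> \<Longrightarrow> I \<in> indep \<Psi> \<Longrightarrow> B \<subseteq> I \<Longrightarrow> I = B"
  unfolding bases_def by blast

lemma basesI: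
  "B \<in> indep \<Psi> \<Longrightarrow> (\<And>I. I \<in> indep \<Psi> \<Longrightarrow> B \<subseteq> I \<Longrightarrow> I = B) \<Longrightarrow> B \<in> bases \<Psi>"
  unfolding bases_def by blast

lemma finite_basis: "ordered_complex \<Psi> \<Longrightarrow> B \<in> bases \<Psi> \<Longrightarrow> finite B"
  using bases_indep finite_indep_member by blast

lemma basis_extension:
  assumes "ordered_complex \<Psi>" "I \<in> indep \<Psi>"
  obtains B where "B \<in> bases \<Psi>" "I \<subseteq> B"
  using finite_has_maximal2[OF finite_indep[OF assms(1)] assms(2)] basesI by metis

lemma bases_nonempty: "ordered_complex \<Psi> \<Longrightarrow> bases \<Psi> \<noteq> {}"
  by (metis basis_extension empty_iff ordered_complex_def abstract_complex_def)

lemma pure_card: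
  "pure \<Psi> \<Longrightarrow> B \<in> bases \<Psi> \<Longrightarrow> B' \<in> bases \<Psi> \<Longrightarrow> card B = card B'"
  unfolding pure_def by blast

lemma complex_rank_eq_card:
  assumes \<Psi>: "ordered_complex \<Psi>" "pure \<Psi>" and B: "B \<in> bases \<Psi>"
  shows "complex_rank \<Psi> = card B"
  unfolding complex_rank_def
proof (rule Max_eqI)
  show "finite (card ` indep \<Psi>)"
    using finite_indep[OF \<Psi>(1)] by simp
  show "card B \<in> card ` indep \<Psi>"
    using bases_indep[OF B] by simp
next
  fix n assume "n \<in> card ` indep \<Psi>"
  then obtain I where I: "I \<in> indep \<Psi>" "n = card I" by blast
  obtain B' where "B' \<in> bases \<Psi>" "I \<subseteq> B'"
    using basis_extension[OF \<Psi>(1) I(1)] .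
  then show "n \<le> card B"
    using card_mono[OF finite_basis[OF \<Psi>(1)]] pure_card[OF \<Psi>(2) B] I(2) by metis
qed

lemma bases_eqI:
  assumes "ordered_complex \<Psi>" "pure \<Psi>" "B \<in> bases \<Psi>" "I \<in> indep \<Psi>" "card I = card B"
  shows "I \<in> bases \<Psi>"
proof -
  obtain B' where "B' \<in> bases \<Psi>" "I \<subseteq> B'"
    using basis_extension[OF assms(1,4)] .
  moreover have "I = B'"
    using calculation assms finite_basis[OF assms(1)] pure_card[OF assms(2)] card_subset_eq by metis
  ultimately show ?thesis by simp
qed

lemma less_in_trans:
  "ordered_complex \<Psi> \<Longrightarrow> (x, y) \<in> ord \<Psi> \<Longrightarrow> less_in \<Psi> y z \<Longrightarrow> less_in \<Psi> x z"
  unfolding ordered_complex_def less_in_def order_on_defs by (metis antisymD transD)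

lemma max_exists:
  assumes \<Psi>: "ordered_complex \<Psi>" and "finite S" "S \<noteq> {}" "S \<subseteq> ground \<Psi>"
  shows "\<exists>m. is_max \<Psi> S m"
  using assms(2-)
proof (induction S rule: finite_ne_induct)
  have lin: "linear_order_on (ground \<Psi>) (ord \<Psi>)"
    using \<Psi> unfolding ordered_complex_def by blast
  {
    case (singleton x)
    then show ?case
      using lin unfolding is_max_def order_on_defs refl_on_def by blast
  next
    case (insert x F)
    then obtain m where m: "m \<in> F" "\<forall>y\<in>F. (y, m) \<in> ord \<Psi>"
      unfolding is_max_def by blast
    have "x \<in> ground \<Psi>" "m \<in> ground \<Psi>"
      using insert.prems m(1) by blast+
    then have xm: "(x, x) \<in> ord \<Psi>" "(x, m) \<in> ord \<Psi> \<or> (m, x) \<in> ord \<Psi>"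
      using lin unfolding order_on_defs refl_on_def total_on_def by (blast, metis)
    have "(y, x) \<in> ord \<Psi>" if "(m, x) \<in> ord \<Psi>" "y \<in> F" for y
      using lin m(2) that unfolding order_on_defs by (meson transD)
    then show ?case
      using m xm unfolding is_max_def by (metis insert_iff)
  }
qed

section \<open>The exchange condition of \<open>QE\<close> in domination form\<close>

lemma QE_complex: "\<Psi> \<in> QE \<Longrightarrow> ordered_complex \<Psi>"
  and QE_pure: "\<Psi> \<in> QE \<Longrightarrow> pure \<Psi>"
  unfolding QE_def by blast+

text \<open>Domination of the whole difference replaces the maximum of the definition. That maximum
  exists because \<open>B2 \<subseteq> B1\<close> would force \<open>B1 = B2\<close> by maximality
  of \<open>B2\<close>, against the choice of \<open>b1\<close>.\<close>

lemma QE_exchange: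
  assumes \<Psi>: "\<Psi> \<in> QE" and B: "B1 \<in> bases \<Psi>" "B2 \<in> bases \<Psi>" "b1 \<in> B1 - B2"
    and less: "\<And>x. x \<in> B2 - B1 \<Longrightarrow> less_in \<Psi> x b1"
  obtains b2 where "b2 \<in> B2 - B1" "insert b2 (B1 - {b1}) \<in> indep \<Psi>"
proof -
  note oc = QE_complex[OF \<Psi>]
  have "B2 - B1 \<noteq> {}"
    using B bases_maximal[OF B(2) bases_indep[OF B(1)]] by blast
  moreover have "finite (B2 - B1)" "B2 - B1 \<subseteq> ground \<Psi>"
    using finite_basis[OF oc B(2)] indep_ground[OF oc bases_indep[OF B(2)]] by auto
  ultimately obtain m where m: "is_max \<Psi> (B2 - B1) m"
    using max_exists[OF oc] by blast
  then have "less_in \<Psi> m b1"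
    using less unfolding is_max_def by blast
  with m \<Psi> B that show ?thesis
    unfolding QE_def by blast
qed

text \<open>Transitivity extends domination from the maximum of \<open>B2 - B1\<close> to the whole
  difference. The maximum also witnesses nonemptiness, which serves proofs that pick an arbitrary
  element of \<open>B2 - B1\<close>.\<close>

lemma QEI:
  assumes oc: "ordered_complex \<Psi>" "pure \<Psi>"
    and exch: "\<And>B1 B2 b1. B1 \<in> bases \<Psi> \<Longrightarrow> B2 \<in> bases \<Psi> \<Longrightarrow> b1 \<in> B1 - B2 \<Longrightarrow>
      B2 - B1 \<noteq> {} \<Longrightarrow> (\<And>x. x \<in> B2 - B1 \<Longrightarrow> less_in \<Psi> x b1) \<Longrightarrow>
      \<exists>b2\<in>B2 - B1. insert b2 (B1 - {b1}) \<in> indep \<Psi>"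
  shows "\<Psi> \<in> QE"
proof -
  have "\<exists>b2\<in>B2 - B1. insert b2 (B1 - {b1}) \<in> indep \<Psi>"
    if "B1 \<in> bases \<Psi>" "B2 \<in> bases \<Psi>" "b1 \<in> B1 - B2" "is_max \<Psi> (B2 - B1) m" "less_in \<Psi> m b1"
    for B1 B2 b1 m
    using exch[OF that(1-3)] that(4,5) less_in_trans[OF oc(1)] unfolding is_max_def by blast
  then show ?thesis
    using oc unfolding QE_def by blast
qed

section \<open>Restrictions and contractions\<close>

lemma restriction_simps [simp]:
  "ground (restriction \<Psi> A) = A"
  "indep (restriction \<Psi> A) = {I \<in> indep \<Psi>. I \<subseteq> A}"
  "less_in (restriction \<Psi> A) x y \<longleftrightarrow> less_in \<Psi> x y \<and> x \<in> A \<and> y \<in> A"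
  unfolding restriction_def less_in_def by auto

lemma linear_order_on_Restr:
  "linear_order_on E r \<Longrightarrow> A \<subseteq> E \<Longrightarrow> linear_order_on A (Restr r A)"
  unfolding order_on_defs refl_on_def trans_def antisym_def total_on_def by blast

lemma ordered_complex_restriction:
  assumes "ordered_complex \<Psi>" "A \<subseteq> ground \<Psi>"
  shows "ordered_complex (restriction \<Psi> A)"
  using assms finite_subset[OF assms(2)] linear_order_on_Restr[of "ground \<Psi>" "ord \<Psi>" A]
  unfolding ordered_complex_def abstract_complex_def restriction_def by auto

lemma bases_restrictionI: "B \<in> bases \<Psi> \<Longrightarrow> B \<subseteq> A \<Longrightarrow> B \<in> bases (restriction \<Psi> A)"
  unfolding bases_def by auto

text \<open>The new element comes from \<open>B2 \<subseteq> A\<close>, so an exchange performed in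
  the whole complex stays inside \<open>A\<close>.\<close>

lemma QE_restriction:
  assumes \<Psi>: "\<Psi> \<in> QE" and A: "A \<subseteq> ground \<Psi>"
    and bases: "bases (restriction \<Psi> A) \<subseteq> bases \<Psi>"
  shows "restriction \<Psi> A \<in> QE"
proof (rule QEI)
  show "ordered_complex (restriction \<Psi> A)"
    using ordered_complex_restriction[OF QE_complex[OF \<Psi>] A] .
  show "pure (restriction \<Psi> A)"
    using QE_pure[OF \<Psi>] bases unfolding pure_def by blast
next
  fix B1 B2 b1
  assume B: "B1 \<in> bases (restriction \<Psi> A)" "B2 \<in> bases (restriction \<Psi> A)" "b1 \<in> B1 - B2"
    and less: "\<And>x. x \<in> B2 - B1 \<Longrightarrow> less_in (restriction \<Psi> A) x b1"
  have sub: "B1 \<subseteq> A" "B2 \<subseteq> A"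
    using B bases_indep by fastforce+
  obtain b2 where "b2 \<in> B2 - B1" "insert b2 (B1 - {b1}) \<in> indep \<Psi>"
    using QE_exchange[OF \<Psi>, of B1 B2 b1] B bases less by auto
  then show "\<exists>b2\<in>B2 - B1. insert b2 (B1 - {b1}) \<in> indep (restriction \<Psi> A)"
    using sub by auto
qed

text \<open>Part (ii): equal ranks give the bases of the restriction the size of the bases of
  \<open>\<Psi>\<close>, and by purity an independent set of that size is a basis.\<close>

lemma QE_restriction_full_rank:
  assumes \<Psi>: "\<Psi> \<in> QE" and U: "U \<subseteq> ground \<Psi>" "pure (restriction \<Psi> U)"
    and rank: "complex_rank (restriction \<Psi> U) = complex_rank \<Psi>"
  shows "restriction \<Psi> U \<in> QE"
proof (rule QE_restriction[OF \<Psi> U(1)], rule subsetI)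
  fix B assume B: "B \<in> bases (restriction \<Psi> U)"
  note oc = QE_complex[OF \<Psi>] and p = QE_pure[OF \<Psi>]
  obtain B' where B': "B' \<in> bases \<Psi>"
    using bases_nonempty[OF oc] by blast
  have "card B = card B'"
    using complex_rank_eq_card[OF ordered_complex_restriction[OF oc U(1)] U(2) B]
      complex_rank_eq_card[OF oc p B'] rank by simp
  then show "B \<in> bases \<Psi>"
    using bases_eqI[OF oc p B'] bases_indep[OF B] by simp
qed

text \<open>Common core of (iii) and of deletion. For each basis \<open>B\<close> leaving
  \<open>A\<close>, \<open>dom\<close> supplies an element outside \<open>A\<close> that can be
  exchanged against \<open>B0\<close>; this prevents \<open>B\<close> from containing a basis of the
  restriction. The rank is kept because \<open>B0\<close> is a basis of both complexes.\<close>

lemma QE_restriction_dominated: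
  assumes \<Psi>: "\<Psi> \<in> QE" and A: "A \<subseteq> ground \<Psi>" and B0: "B0 \<in> bases \<Psi>" "B0 \<subseteq> A"
    and dom: "\<And>B. B \<in> bases \<Psi> \<Longrightarrow> \<not> B \<subseteq> A \<Longrightarrow> \<exists>b\<in>B - A. \<forall>x\<in>B0 - B. less_in \<Psi> x b"
  shows "restriction \<Psi> A \<in> QE" and "complex_rank (restriction \<Psi> A) = complex_rank \<Psi>"
proof -
  note oc = QE_complex[OF \<Psi>]
  have "C \<in> bases \<Psi>" if C: "C \<in> bases (restriction \<Psi> A)" for C
  proof -
    have CA: "C \<in> indep \<Psi>" "C \<subseteq> A"
      using bases_indep[OF C] by auto
    obtain B where B: "B \<in> bases \<Psi>" "C \<subseteq> B"
      using basis_extension[OF oc CA(1)] .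
    have "B \<subseteq> A"
    proof (rule ccontr)
      assume "\<not> B \<subseteq> A"
      then obtain b where b: "b \<in> B - A" "\<And>x. x \<in> B0 - B \<Longrightarrow> less_in \<Psi> x b"
        using dom B(1) by blast
      have "b \<in> B - B0"
        using b(1) B0(2) by blast
      then obtain b2 where b2: "b2 \<in> B0 - B" "insert b2 (B - {b}) \<in> indep \<Psi>"
        using QE_exchange[OF \<Psi> B(1) B0(1)] b(2) by metis
      \<comment> \<open>Since \<open>b\<close> lies outside \<open>A\<close> and \<open>C\<close>
        inside it, removing \<open>b\<close> leaves \<open>C\<close> intact; \<open>b2\<close>
        belongs to \<open>B0 \<subseteq> A\<close>, so it enlarges \<open>C\<close> within
        \<open>A\<close>.\<close>
      have "insert b2 C \<in> indep \<Psi>"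
        by (rule indep_subset[OF oc b2(2)]) (use B(2) CA(2) b(1) in blast)
      then have "insert b2 C = C"
        using bases_maximal[OF C, of "insert b2 C"] b2(1) B0(2) CA(2) by auto
      then show False
        using b2(1) B(2) by blast
    qed
    then have "B = C"
      using bases_maximal[OF C, of B] bases_indep[OF B(1)] B(2) by simp
    with B show ?thesis by simp
  qed
  then show QE: "restriction \<Psi> A \<in> QE"
    using QE_restriction[OF \<Psi> A] by blast
  show "complex_rank (restriction \<Psi> A) = complex_rank \<Psi>"
    using complex_rank_eq_card[OF QE_complex[OF QE] QE_pure[OF QE] bases_restrictionI[OF B0]]
      complex_rank_eq_card[OF oc QE_pure[OF \<Psi>] B0(1)] by simp
qed

text \<open>Part (iii). Coloops lie in every basis, so \<open>B0 - B\<close> is bounded by the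
  largest non-coloop \<open>m\<close> of \<open>B0\<close>. An element of \<open>B\<close> outside
  \<open>A\<close> is neither \<open>m\<close> nor below it, hence exceeds all of
  \<open>B0 - B\<close>.\<close>

lemma QE_restriction_initial:
  assumes \<Psi>: "\<Psi> \<in> QE" and A: "A \<subseteq> ground \<Psi>" and B0: "B0 \<in> bases \<Psi>" "B0 \<subseteq> A"
    and below: "\<And>m. is_max \<Psi> (B0 - coloops \<Psi>) m \<Longrightarrow> {e \<in> ground \<Psi>. less_in \<Psi> e m} \<subseteq> A"
  shows "restriction \<Psi> A \<in> QE"
proof (rule QE_restriction_dominated(1)[OF \<Psi> A B0])
  fix B assume B: "B \<in> bases \<Psi>" "\<not> B \<subseteq> A"
  note oc = QE_complex[OF \<Psi>]
  have lin: "linear_order_on (ground \<Psi>) (ord \<Psi>)"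
    using oc unfolding ordered_complex_def by blast
  have B0g: "B0 \<subseteq> ground \<Psi>" and Bg: "B \<subseteq> ground \<Psi>"
    using indep_ground[OF oc bases_indep] B0(1) B(1) by blast+
  obtain b where b: "b \<in> B - A" using B(2) by blast
  have co: "B0 - B \<subseteq> B0 - coloops \<Psi>"
    using B(1) unfolding coloops_def by blast
  \<comment> \<open>Otherwise \<open>B = B0\<close> by maximality, although \<open>B0\<close> lies
    in \<open>A\<close> and \<open>B\<close> does not.\<close>
  have "B0 - B \<noteq> {}"
    using bases_maximal[OF B0(1) bases_indep[OF B(1)]] b B0(2) by blast
  then obtain m where m: "is_max \<Psi> (B0 - coloops \<Psi>) m"
    using max_exists[OF oc, of "B0 - coloops \<Psi>"] co B0g finite_basis[OF oc B0(1)] by blast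
  then have mB0: "m \<in> B0" unfolding is_max_def by blast
  have "\<not> less_in \<Psi> b m" "b \<noteq> m"
    using below[OF m] b Bg mB0 B0(2) by blast+
  then have "less_in \<Psi> m b"
    using lin mB0 b B0g Bg unfolding order_on_defs total_on_def less_in_def by blast
  then have "\<forall>x\<in>B0 - B. less_in \<Psi> x b"
    using m co less_in_trans[OF oc] unfolding is_max_def by blast
  with b show "\<exists>b\<in>B - A. \<forall>x\<in>B0 - B. less_in \<Psi> x b" by blast
qed

text \<open>The set \<open>S\<close> covers two uses: the whole ground set for closure under
  deletion, and the non-coloop vertices for the recursion of \<open>PURE\<close>. A basis
  \<open>B0\<close> avoiding \<open>e\<close> serves as the fixed basis inside the
  restriction.\<close>

lemma QE_deletion:
  assumes \<Psi>: "\<Psi> \<in> QE" and e: "is_max \<Psi> S e" "e \<in> ground \<Psi>" "e \<notin> coloops \<Psi>"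
    and S: "vertices \<Psi> - coloops \<Psi> \<subseteq> S"
  shows "deletion \<Psi> e \<in> QE" and "complex_rank (deletion \<Psi> e) = complex_rank \<Psi>"
proof -
  note oc = QE_complex[OF \<Psi>]
  obtain B0 where B0: "B0 \<in> bases \<Psi>" "e \<notin> B0"
    using e(2,3) unfolding coloops_def by blast
  have B0g: "B0 \<subseteq> ground \<Psi>"
    using indep_ground[OF oc bases_indep] B0(1) by blast
  have dom: "\<exists>b\<in>B - (ground \<Psi> - {e}). \<forall>x\<in>B0 - B. less_in \<Psi> x b"
    if B: "B \<in> bases \<Psi>" "\<not> B \<subseteq> ground \<Psi> - {e}" for B
  proof -
    have "e \<in> B"
      using indep_ground[OF oc bases_indep[OF B(1)]] B(2) by blast
    moreover have "less_in \<Psi> x e" if x: "x \<in> B0 - B" for x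
    proof -
      \<comment> \<open>Membership in \<open>B0\<close> makes \<open>x\<close> a vertex, absence
        from \<open>B\<close> makes it no coloop. Thus \<open>e\<close> bounds \<open>x\<close>, and
        strictly so because \<open>e \<notin> B0\<close>.\<close>
      have "x \<in> vertices \<Psi> - coloops \<Psi>"
        using x B0(1) B0g B(1) unfolding vertices_def loops_def coloops_def by blast
      then show ?thesis
        using S e(1) x B0(2) unfolding is_max_def less_in_def by blast
    qed
    ultimately show ?thesis by blast
  qed
  show "deletion \<Psi> e \<in> QE" "complex_rank (deletion \<Psi> e) = complex_rank \<Psi>"
    unfolding deletion_def
    using QE_restriction_dominated[OF \<Psi> _ B0(1) _ dom] B0 B0g by blast+
qed

section \<open>Contractions of independent sets\<close>

lemma contraction_simps [simp]:
  "ground (contraction \<Psi> I) = ground \<Psi> - I"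
  "indep (contraction \<Psi> I) = {J. J \<subseteq> ground \<Psi> - I \<and> J \<union> I \<in> indep \<Psi>}"
  "less_in (contraction \<Psi> I) x y \<longleftrightarrow>
     less_in \<Psi> x y \<and> x \<in> ground \<Psi> - I \<and> y \<in> ground \<Psi> - I"
  unfolding contraction_def less_in_def by auto

lemma ordered_complex_contraction:
  assumes \<Psi>: "ordered_complex \<Psi>" and I: "I \<in> indep \<Psi>"
  shows "ordered_complex (contraction \<Psi> I)"
proof -
  have "J' \<union> I \<in> indep \<Psi>" if "J \<union> I \<in> indep \<Psi>" "J' \<subseteq> J" for J J'
    by (rule indep_subset[OF \<Psi> that(1)]) (use that(2) in blast)
  moreover have "linear_order_on (ground \<Psi> - I) (Restr (ord \<Psi>) (ground \<Psi> - I))"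
    using \<Psi> linear_order_on_Restr Diff_subset unfolding ordered_complex_def by metis
  ultimately show ?thesis
    using finite_ground[OF \<Psi>] I
    unfolding ordered_complex_def abstract_complex_def contraction_def by auto
qed

lemma bases_contraction:
  assumes \<Psi>: "ordered_complex \<Psi>" and C: "C \<in> bases (contraction \<Psi> I)"
  shows "C \<union> I \<in> bases \<Psi>" "C \<inter> I = {}"
proof -
  have C': "C \<subseteq> ground \<Psi> - I" "C \<union> I \<in> indep \<Psi>"
    using bases_indep[OF C] by auto
  then show "C \<inter> I = {}" by blast
  show "C \<union> I \<in> bases \<Psi>"
  proof (rule basesI[OF C'(2)])
    fix J assume J: "J \<in> indep \<Psi>" "C \<union> I \<subseteq> J"
    \<comment> \<open>As \<open>J\<close> contains \<open>I\<close>, removing \<open>I\<close> and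
      adding it back returns \<open>J\<close>; so \<open>J - I\<close> is a face of the contraction
      above its basis \<open>C\<close>.\<close>
    then have "J - I \<in> indep (contraction \<Psi> I)"
      using indep_ground[OF \<Psi> J(1)] by (auto simp: Un_absorb2)
    then have "J - I = C"
      using bases_maximal[OF C] J(2) C'(1) by blast
    then show "J = C \<union> I" using J(2) by blast
  qed
qed

text \<open>Adding \<open>I\<close> to two bases of the contraction changes neither of their
  differences, and the exchange keeps \<open>I\<close> because \<open>c\<close> lies outside it.
  Sizes shift by the constant \<open>card I\<close>, so purity passes over.\<close>

lemma QE_contraction:
  assumes \<Psi>: "\<Psi> \<in> QE" and I: "I \<in> indep \<Psi>"
  shows "contraction \<Psi> I \<in> QE"
proof (rule QEI)
  note oc = QE_complex[OF \<Psi>]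
  note bc = bases_contraction[OF oc]
  show "ordered_complex (contraction \<Psi> I)"
    using ordered_complex_contraction[OF oc I] .
  have card: "card (C \<union> I) = card C + card I" if "C \<in> bases (contraction \<Psi> I)" for C
    using card_Un_disjoint[OF _ _ bc(2)[OF that]] finite_basis[OF oc bc(1)[OF that]] by simp
  show "pure (contraction \<Psi> I)"
    unfolding pure_def using card pure_card[OF QE_pure[OF \<Psi>] bc(1) bc(1)]
    by (metis add_right_cancel)
  fix C1 C2 c
  assume C: "C1 \<in> bases (contraction \<Psi> I)" "C2 \<in> bases (contraction \<Psi> I)" "c \<in> C1 - C2"
    and less: "\<And>x. x \<in> C2 - C1 \<Longrightarrow> less_in (contraction \<Psi> I) x c"
  have "c \<in> (C1 \<union> I) - (C2 \<union> I)"
    using C(3) bc(2)[OF C(1)] by blast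
  moreover have "\<And>x. x \<in> (C2 \<union> I) - (C1 \<union> I) \<Longrightarrow> less_in \<Psi> x c"
    using less by auto
  ultimately obtain b where b: "b \<in> (C2 \<union> I) - (C1 \<union> I)" "insert b (C1 \<union> I - {c}) \<in> indep \<Psi>"
    using QE_exchange[OF \<Psi> bc(1)[OF C(1)] bc(1)[OF C(2)]] by metis
  have "insert b (C1 \<union> I - {c}) = insert b (C1 - {c}) \<union> I"
    using C(3) bc(2)[OF C(1)] by blast
  moreover have "insert b (C1 - {c}) \<subseteq> ground \<Psi> - I"
    using indep_ground[OF oc b(2)] b(1) bc(2)[OF C(1)] bases_indep[OF C(1)] by auto
  ultimately show "\<exists>b\<in>C2 - C1. insert b (C1 - {c}) \<in> indep (contraction \<Psi> I)"
    using b by auto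
qed

text \<open>Brings (iv) under the contraction of an independent set.\<close>

lemma vertex_indep: "ordered_complex \<Psi> \<Longrightarrow> v \<in> vertices \<Psi> \<Longrightarrow> {v} \<in> indep \<Psi>"
  unfolding vertices_def loops_def using indep_subset[of \<Psi> _ "{v}"] bases_indep by fastforce

section \<open>Joins\<close>

lemma join_simps [simp]:
  "ground (join S s j j' \<Psi> \<Psi>') = S"
  "indep (join S s j j' \<Psi> \<Psi>') = {j ` I \<union> j' ` I' | I I'. I \<in> indep \<Psi> \<and> I' \<in> indep \<Psi>'}"
  "less_in (join S s j j' \<Psi> \<Psi>') x y \<longleftrightarrow> (x, y) \<in> s \<and> x \<noteq> y"
  unfolding join_def less_in_def by auto

text \<open>Swapping the factors reduces exchange in a join to the case where the removed element
  comes from the left factor.\<close>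

lemma join_commute: "join S s j j' \<Psi> \<Psi>' = join S s j' j \<Psi>' \<Psi>"
  unfolding join_def by (auto intro: Un_commute)

lemma is_shuffle_commute: "is_shuffle E r E' r' S s j j' \<Longrightarrow> is_shuffle E' r' E r S s j' j"
  unfolding is_shuffle_def by blast

lemma ordered_complex_join:
  assumes oc: "ordered_complex \<Psi>" "ordered_complex \<Psi>'"
    and sh: "is_shuffle (ground \<Psi>) (ord \<Psi>) (ground \<Psi>') (ord \<Psi>') S s j j'"
  shows "ordered_complex (join S s j j' \<Psi> \<Psi>')"
proof -
  let ?J = "{j ` I \<union> j' ` I' | I I'. I \<in> indep \<Psi> \<and> I' \<in> indep \<Psi>'}"
  have S: "S = j ` ground \<Psi> \<union> j' ` ground \<Psi>'" and lin: "linear_order_on S s"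
    using sh unfolding is_shuffle_def by blast+
  have "finite S"
    unfolding S using finite_ground[OF oc(1)] finite_ground[OF oc(2)] by simp
  moreover have "?J \<subseteq> Pow S"
    unfolding S using indep_ground[OF oc(1)] indep_ground[OF oc(2)] by fast
  moreover have "{} \<in> indep \<Psi>" "{} \<in> indep \<Psi>'"
    using oc unfolding ordered_complex_def abstract_complex_def by blast+
  then have "{} \<in> ?J"
    by force
  moreover have "K \<in> ?J" if L: "L \<in> ?J" "K \<subseteq> L" for K L
  proof -
    obtain I I' where I: "L = j ` I \<union> j' ` I'" "I \<in> indep \<Psi>" "I' \<in> indep \<Psi>'"
      using L(1) by blast
    \<comment> \<open>The traces of \<open>K\<close> on the two images are pulled back to subsets of
      \<open>I\<close> and \<open>I'\<close>.\<close>
    have "K = j ` (I \<inter> j -` K) \<union> j' ` (I' \<inter> j' -` K)"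
      using L(2) I(1) by blast
    moreover have "I \<inter> j -` K \<in> indep \<Psi>" "I' \<inter> j' -` K \<in> indep \<Psi>'"
      by (rule indep_subset[OF oc(1) I(2)] indep_subset[OF oc(2) I(3)], blast)+
    ultimately show ?thesis by blast
  qed
  ultimately show ?thesis
    using lin unfolding ordered_complex_def abstract_complex_def join_def by auto
qed

text \<open>The two parts of \<open>B\<close> extend to bases of the factors; the union of their
  images is independent and contains \<open>B\<close>, so it equals \<open>B\<close>.\<close>

lemma bases_join:
  assumes oc: "ordered_complex \<Psi>" "ordered_complex \<Psi>'"
    and B: "B \<in> bases (join S s j j' \<Psi> \<Psi>')"
  obtains C C' where "C \<in> bases \<Psi>" "C' \<in> bases \<Psi>'" "B = j ` C \<union> j' ` C'"
proof -
  obtain I I' where I: "I \<in> indep \<Psi>" "I' \<in> indep \<Psi>'" "B = j ` I \<union> j' ` I'"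
    using bases_indep[OF B] by auto
  obtain C where C: "C \<in> bases \<Psi>" "I \<subseteq> C"
    using basis_extension[OF oc(1) I(1)] .
  obtain C' where C': "C' \<in> bases \<Psi>'" "I' \<subseteq> C'"
    using basis_extension[OF oc(2) I(2)] .
  have "j ` C \<union> j' ` C' = B"
  proof (rule bases_maximal[OF B])
    show "j ` C \<union> j' ` C' \<in> indep (join S s j j' \<Psi> \<Psi>')"
      using bases_indep[OF C(1)] bases_indep[OF C'(1)] by auto
    show "B \<subseteq> j ` C \<union> j' ` C'"
      using I(3) C(2) C'(2) by blast
  qed
  with C(1) C'(1) that show ?thesis by metis
qed

text \<open>The exchange takes place entirely in \<open>\<Psi>\<close>, with the right part
  \<open>C1'\<close> kept, because domination in the join induces domination in
  \<open>\<Psi>\<close>.\<close>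

lemma join_exchange_left:
  assumes \<Psi>: "\<Psi> \<in> QE" and oc': "ordered_complex \<Psi>'"
    and sh: "is_shuffle (ground \<Psi>) (ord \<Psi>) (ground \<Psi>') (ord \<Psi>') S s j j'"
    and C: "C1 \<in> bases \<Psi>" "C2 \<in> bases \<Psi>" "C1' \<in> bases \<Psi>'" "C2' \<in> bases \<Psi>'"
    and c: "c \<in> C1" "j c \<notin> j ` C2"
    and less: "\<And>x. x \<in> (j ` C2 \<union> j' ` C2') - (j ` C1 \<union> j' ` C1') \<Longrightarrow> (x, j c) \<in> s \<and> x \<noteq> j c"
  shows "\<exists>b\<in>(j ` C2 \<union> j' ` C2') - (j ` C1 \<union> j' ` C1').
           insert b ((j ` C1 \<union> j' ` C1') - {j c}) \<in> indep (join S s j j' \<Psi> \<Psi>')"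
proof -
  note oc = QE_complex[OF \<Psi>]
  have lin: "linear_order_on (ground \<Psi>) (ord \<Psi>)" and antisym: "antisym s"
    and inj: "inj_on j (ground \<Psi>)" and pres: "\<And>x y. (x, y) \<in> ord \<Psi> \<Longrightarrow> (j x, j y) \<in> s"
    and disj: "j ` ground \<Psi> \<inter> j' ` ground \<Psi>' = {}"
    using oc sh unfolding is_shuffle_def ordered_complex_def order_on_defs by blast+
  have g: "C1 \<subseteq> ground \<Psi>" "C2 \<subseteq> ground \<Psi>" "C1' \<subseteq> ground \<Psi>'"
    using C indep_ground[OF oc bases_indep] indep_ground[OF oc' bases_indep] by blast+
  \<comment> \<open>Injectivity keeps \<open>j x\<close> out of the image of \<open>C1\<close>,
    disjointness of the two images out of that of \<open>C1'\<close>.\<close>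
  have new: "j x \<in> (j ` C2 \<union> j' ` C2') - (j ` C1 \<union> j' ` C1')" if "x \<in> C2 - C1" for x
    using that g disj inj_on_image_mem_iff[OF inj, of x C1] by blast
  have "less_in \<Psi> x c" if x: "x \<in> C2 - C1" for x
  proof -
    have "(j x, j c) \<in> s" "j x \<noteq> j c"
      using less[OF new[OF x]] by blast+
    \<comment> \<open>The shuffle only states that \<open>j\<close> preserves the order;
      antisymmetry of \<open>s\<close> makes \<open>j\<close> reflect it, and totality then puts
      \<open>x\<close> strictly below \<open>c\<close>.\<close>
    then have "(c, x) \<notin> ord \<Psi>" "x \<noteq> c"
      using pres antisym unfolding antisym_def by blast+
    moreover have "x \<in> ground \<Psi>" "c \<in> ground \<Psi>"
      using x c(1) g by blast+
    ultimately show ?thesis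
      using lin unfolding order_on_defs total_on_def less_in_def by blast
  qed
  then obtain b where b: "b \<in> C2 - C1" "insert b (C1 - {c}) \<in> indep \<Psi>"
    using QE_exchange[OF \<Psi> C(1,2), of c] c by blast
  \<comment> \<open>Removing \<open>j c\<close> from the join basis amounts to removing
    \<open>c\<close> from \<open>C1\<close>.\<close>
  have "j c \<notin> j' ` C1'" "j ` (C1 - {c}) = j ` C1 - {j c}"
    using disj c(1) g inj_on_image_set_diff[OF inj, of C1 "{c}"] by blast+
  then have "insert (j b) ((j ` C1 \<union> j' ` C1') - {j c}) = j ` insert b (C1 - {c}) \<union> j' ` C1'"
    by auto
  then have "insert (j b) ((j ` C1 \<union> j' ` C1') - {j c}) \<in> indep (join S s j j' \<Psi> \<Psi>')"
    using b(2) bases_indep[OF C(3)] unfolding join_simps by blast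
  with new[OF b(1)] show ?thesis by blast
qed

lemma QE_join:
  assumes \<Psi>: "\<Psi> \<in> QE" and \<Psi>': "\<Psi>' \<in> QE"
    and sh: "is_shuffle (ground \<Psi>) (ord \<Psi>) (ground \<Psi>') (ord \<Psi>') S s j j'"
  shows "join S s j j' \<Psi> \<Psi>' \<in> QE"
proof (rule QEI)
  let ?\<Phi> = "join S s j j' \<Psi> \<Psi>'"
  note oc = QE_complex[OF \<Psi>] QE_complex[OF \<Psi>']
  show "ordered_complex ?\<Phi>"
    using ordered_complex_join[OF oc sh] .
  have inj: "inj_on j (ground \<Psi>)" "inj_on j' (ground \<Psi>')"
    and disj: "j ` ground \<Psi> \<inter> j' ` ground \<Psi>' = {}"
    using sh unfolding is_shuffle_def by blast+
  \<comment> \<open>Sizes add because the maps are injective with disjoint images; purity of the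
    join then follows from that of the factors.\<close>
  have card: "card (j ` C \<union> j' ` C') = card C + card C'"
    if C: "C \<in> bases \<Psi>" "C' \<in> bases \<Psi>'" for C C'
  proof -
    have g: "C \<subseteq> ground \<Psi>" "C' \<subseteq> ground \<Psi>'"
      using C indep_ground[OF oc(1) bases_indep] indep_ground[OF oc(2) bases_indep] by blast+
    have "j ` C \<inter> j' ` C' = {}"
      using g disj by blast
    then show ?thesis
      using card_Un_disjoint[of "j ` C" "j' ` C'"] finite_basis[OF oc(1) C(1)]
        finite_basis[OF oc(2) C(2)] card_image[OF inj_on_subset[OF inj(1) g(1)]]
        card_image[OF inj_on_subset[OF inj(2) g(2)]] by simp
  qed
  show "pure ?\<Phi>"
    unfolding pure_def
  proof (intro ballI)
    fix B B' assume "B \<in> bases ?\<Phi>" "B' \<in> bases ?\<Phi>"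
    then show "card B = card B'"
      using bases_join[OF oc] card pure_card[OF QE_pure[OF \<Psi>]] pure_card[OF QE_pure[OF \<Psi>']]
      by metis
  qed
  fix B1 B2 b1
  assume B: "B1 \<in> bases ?\<Phi>" "B2 \<in> bases ?\<Phi>" "b1 \<in> B1 - B2"
    and less: "\<And>x. x \<in> B2 - B1 \<Longrightarrow> less_in ?\<Phi> x b1"
  obtain C1 C1' where C1: "C1 \<in> bases \<Psi>" "C1' \<in> bases \<Psi>'" "B1 = j ` C1 \<union> j' ` C1'"
    using bases_join[OF oc B(1)] .
  obtain C2 C2' where C2: "C2 \<in> bases \<Psi>" "C2' \<in> bases \<Psi>'" "B2 = j ` C2 \<union> j' ` C2'"
    using bases_join[OF oc B(2)] .
  consider c where "c \<in> C1" "b1 = j c" | c where "c \<in> C1'" "b1 = j' c"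
    using B(3) C1(3) by blast
  then show "\<exists>b2\<in>B2 - B1. insert b2 (B1 - {b1}) \<in> indep ?\<Phi>"
  proof cases
    case 1
    then show ?thesis
      using join_exchange_left[OF \<Psi> oc(2) sh C1(1) C2(1) C1(2) C2(2)] B(3) less C1(3) C2(3)
      by auto
  next
    case 2
    \<comment> \<open>An element of the right factor becomes one of the left factor once the factors
      are swapped.\<close>
    have "\<exists>b\<in>(j' ` C2' \<union> j ` C2) - (j' ` C1' \<union> j ` C1).
        insert b ((j' ` C1' \<union> j ` C1) - {j' c}) \<in> indep (join S s j' j \<Psi>' \<Psi>)"
    proof (rule join_exchange_left[OF \<Psi>' oc(1) is_shuffle_commute[OF sh]])
      show "j' c \<notin> j' ` C2'"
        using B(3) 2(2) C2(3) by blast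
      show "(x, j' c) \<in> s \<and> x \<noteq> j' c"
        if "x \<in> (j' ` C2' \<union> j ` C2) - (j' ` C1' \<union> j ` C1)" for x
        using less[of x] that C1(3) C2(3) 2(2) by auto
    qed (use C1 C2 2 in auto)
    then show ?thesis
      unfolding C1(3) C2(3) 2(2) join_commute[of S s j] by (simp only: Un_commute)
  qed
qed

section \<open>Matroids and shifted complexes\<close>

text \<open>Augmenting a smaller basis from a larger one would contradict maximality, whence purity;
  augmenting \<open>B1 - {b1}\<close> from \<open>B2\<close> is the exchange.\<close>

lemma ordered_matroid_QE:
  assumes "ordered_matroid \<Psi>"
  shows "\<Psi> \<in> QE"
proof (rule QEI)
  show oc: "ordered_complex \<Psi>"
    using assms unfolding ordered_matroid_def by blast
  have aug: "\<exists>x\<in>J - I. insert x I \<in> indep \<Psi>"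
    if "I \<in> indep \<Psi>" "J \<in> indep \<Psi>" "card I < card J" for I J
    using assms that unfolding ordered_matroid_def matroid_complex_def by blast
  have "card B \<ge> card B'" if B: "B \<in> bases \<Psi>" "B' \<in> bases \<Psi>" for B B'
  proof (rule ccontr)
    assume "\<not> card B \<ge> card B'"
    then obtain x where "x \<in> B' - B" "insert x B \<in> indep \<Psi>"
      using aug[OF bases_indep[OF B(1)] bases_indep[OF B(2)]] by auto
    then show False
      using bases_maximal[OF B(1)] by blast
  qed
  then show pure: "pure \<Psi>"
    unfolding pure_def by (meson le_antisym)
  fix B1 B2 b1
  assume B: "B1 \<in> bases \<Psi>" "B2 \<in> bases \<Psi>" "b1 \<in> B1 - B2"
  have "card (B1 - {b1}) < card B2"
    using B pure_card[OF pure B(1,2)] card_Diff1_less[OF finite_basis[OF oc B(1)]] by auto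
  moreover have "B1 - {b1} \<in> indep \<Psi>"
    by (rule indep_subset[OF oc bases_indep[OF B(1)]]) blast
  ultimately obtain x where "x \<in> B2 - (B1 - {b1})" "insert x (B1 - {b1}) \<in> indep \<Psi>"
    using aug bases_indep[OF B(2)] by blast
  \<comment> \<open>The augmenting element differs from \<open>b1\<close>, since
    \<open>b1 \<notin> B2\<close>; hence it lies outside \<open>B1\<close>.\<close>
  with B(3) show "\<exists>b2\<in>B2 - B1. insert b2 (B1 - {b1}) \<in> indep \<Psi>" by blast
qed

text \<open>Every element of \<open>B2 - B1\<close> is smaller than \<open>b1\<close>, so
  shiftedness lets any of them replace it.\<close>

lemma shifted_QE:
  assumes oc: "ordered_complex \<Psi>" and "pure \<Psi>" and "shifted \<Psi>"
  shows "\<Psi> \<in> QE"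
proof (rule QEI[OF assms(1,2)])
  fix B1 B2 b1
  assume B: "B1 \<in> bases \<Psi>" "B2 \<in> bases \<Psi>" "b1 \<in> B1 - B2" "B2 - B1 \<noteq> {}"
    and less: "\<And>x. x \<in> B2 - B1 \<Longrightarrow> less_in \<Psi> x b1"
  obtain b2 where b2: "b2 \<in> B2 - B1" using B(4) by blast
  have "b1 \<in> ground \<Psi>" "b2 \<in> ground \<Psi>"
    using B b2 indep_ground[OF oc bases_indep] by blast+
  then have "insert b2 (B1 - {b1}) \<in> bases \<Psi>"
    using assms(3) B(1,3) b2 less[OF b2] unfolding shifted_def by blast
  with b2 show "\<exists>b2\<in>B2 - B1. insert b2 (B1 - {b1}) \<in> indep \<Psi>"
    using bases_indep by blast
qed

section \<open>From exchange under all orderings to matroids\<close>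

lemma linear_order_with_max:
  assumes "e \<in> X"
  obtains r where "linear_order_on X r" "\<And>x. x \<in> X \<Longrightarrow> (x, e) \<in> r"
proof -
  obtain r where "linear_order_on (X - {e}) r" "r \<subseteq> (X - {e}) \<times> (X - {e})"
    using well_order_on[of "X - {e}"] unfolding order_on_defs by blast
  \<comment> \<open>The element \<open>e\<close> is placed on top of an arbitrary linear order of
    the rest.\<close>
  then have "linear_order_on X (r \<union> X \<times> {e})"
    using assms unfolding order_on_defs refl_on_def trans_def antisym_def total_on_def by blast
  then show ?thesis using that by blast
qed

text \<open>If \<open>I\<close> cannot be augmented from \<open>J\<close>, suitable bases
  \<open>B\<close> above \<open>I\<close> and \<open>C\<close> above \<open>J\<close> satisfy
  \<open>C - B = J - I\<close> and \<open>B - C \<subseteq> I - J\<close>. Bases have equal size, so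
  \<open>card J \<le> card I\<close>, a contradiction.\<close>

lemma basis_exchange_matroid:
  assumes \<Psi>: "ordered_complex \<Psi>" "pure \<Psi>"
    and exch: "\<And>B1 B2 b1. B1 \<in> bases \<Psi> \<Longrightarrow> B2 \<in> bases \<Psi> \<Longrightarrow> b1 \<in> B1 - B2 \<Longrightarrow>
      \<exists>b2\<in>B2 - B1. insert b2 (B1 - {b1}) \<in> indep \<Psi>"
  shows "matroid_complex (ground \<Psi>) (indep \<Psi>)"
proof -
  have "\<exists>x\<in>J - I. insert x I \<in> indep \<Psi>"
    if I: "I \<in> indep \<Psi>" and J: "J \<in> indep \<Psi>" and card: "card I < card J" for I J
  proof (rule ccontr)
    assume no: "\<not> (\<exists>x\<in>J - I. insert x I \<in> indep \<Psi>)"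
    obtain B where B: "B \<in> bases \<Psi>" "I \<subseteq> B"
      using basis_extension[OF \<Psi>(1) I] .
    obtain D where "D \<in> bases \<Psi> \<and> J \<subseteq> D"
      using basis_extension[OF \<Psi>(1) J] by blast
    \<comment> \<open>Among the bases above \<open>J\<close>, \<open>C\<close> has the fewest
      elements outside \<open>J \<union> B\<close>; exchanges against \<open>B\<close> will show
      that there are none.\<close>
    then obtain C where C: "C \<in> bases \<Psi>" "J \<subseteq> C"
      and min: "\<And>D. D \<in> bases \<Psi> \<Longrightarrow> J \<subseteq> D \<Longrightarrow> card (C - (J \<union> B)) \<le> card (D - (J \<union> B))"
      using ex_has_least_nat[of "\<lambda>D. D \<in> bases \<Psi> \<and> J \<subseteq> D" D "\<lambda>D. card (D - (J \<union> B))"] by blast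
    note fin = finite_basis[OF \<Psi>(1) B(1)] finite_basis[OF \<Psi>(1) C(1)]
    have "C - (J \<union> B) = {}"
    proof (rule ccontr)
      assume "C - (J \<union> B) \<noteq> {}"
      then obtain x where x: "x \<in> C - (J \<union> B)" by blast
      then obtain y where y: "y \<in> B - C" "insert y (C - {x}) \<in> indep \<Psi>"
        using exch[OF C(1) B(1), of x] by blast
      have "card (insert y (C - {x})) = card C"
        using x y(1) card.remove[of C x] fin(2) by simp
      then have D: "insert y (C - {x}) \<in> bases \<Psi>"
        using bases_eqI[OF \<Psi> C(1) y(2)] by simp
      \<comment> \<open>As \<open>y\<close> comes from \<open>B\<close>, trading \<open>x\<close>
        for it removes \<open>x\<close> from the counted set and adds nothing to it.\<close>
      have "insert y (C - {x}) - (J \<union> B) \<subset> C - (J \<union> B)"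
        using x y(1) by auto
      then have "card (insert y (C - {x}) - (J \<union> B)) < card (C - (J \<union> B))"
        using psubset_card_mono fin(2) by blast
      moreover have "J \<subseteq> insert y (C - {x})"
        using C(2) x by blast
      ultimately show False
        using min[OF D] by simp
    qed
    \<comment> \<open>An element of \<open>J \<inter> B\<close> outside \<open>I\<close> would
      augment \<open>I\<close> inside \<open>B\<close>.\<close>
    moreover have JB: "J \<inter> B \<subseteq> I"
      using no indep_subset[OF \<Psi>(1) bases_indep[OF B(1)]] B(2) by blast
    ultimately have CB: "C - B = J - I"
      using C(2) B(2) by blast
    have "B - C \<subseteq> I - J"
    proof
      fix x assume x: "x \<in> B - C"
      then obtain y where y: "y \<in> C - B" "insert y (B - {x}) \<in> indep \<Psi>"
        using exch[OF B(1) C(1)] by blast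
      have "x \<in> I"
      proof (rule ccontr)
        assume "x \<notin> I"
        \<comment> \<open>Removing \<open>x\<close> from \<open>B\<close> leaves \<open>I\<close>
          intact, so \<open>y\<close>, which lies in \<open>C - B = J - I\<close>, would augment
          \<open>I\<close>.\<close>
        then have "insert y I \<in> indep \<Psi>"
          by (intro indep_subset[OF \<Psi>(1) y(2)]) (use B(2) in blast)
        then show False
          using no y(1) CB by blast
      qed
      then show "x \<in> I - J" using x C(2) by blast
    qed
    then have "card (B - C) \<le> card (I - J)"
      using card_mono finite_indep_member[OF \<Psi>(1) I] by blast
    moreover have "card (B - C) = card (C - B)"
      using pure_card[OF \<Psi>(2) B(1) C(1)] card_Int_Diff[OF fin(1), of C]
        card_Int_Diff[OF fin(2), of B] by (simp add: Int_commute)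
    moreover have "card I = card (I \<inter> J) + card (I - J)" "card J = card (I \<inter> J) + card (J - I)"
      using card_Int_Diff finite_indep_member[OF \<Psi>(1)] I J by (metis Int_commute)+
    ultimately show False
      using card CB by simp
  qed
  then show ?thesis
    using \<Psi>(1) unfolding matroid_complex_def ordered_complex_def by blast
qed

text \<open>Bases do not depend on the ordering. For each \<open>b1\<close> the exchange is
  therefore taken in an ordering with \<open>b1\<close> last, where \<open>b1\<close> dominates
  \<open>B2 - B1\<close> automatically.\<close>

lemma QE_all_orders_matroid:
  assumes all: "\<And>r. linear_order_on X r \<Longrightarrow> \<lparr>ground = X, ord = r, indep = \<Delta>\<rparr> \<in> QE"
  shows "matroid_complex X \<Delta>"
proof -
  let ?\<Psi> = "\<lambda>r. \<lparr>ground = X, ord = r, indep = \<Delta>\<rparr>"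
  have bases: "bases (?\<Psi> r) = bases (?\<Psi> r')" for r r'
    unfolding bases_def by simp
  obtain r where "linear_order_on X r"
    using well_order_on unfolding well_order_on_def by blast
  note \<Psi> = all[OF this]
  have "\<exists>b2\<in>B2 - B1. insert b2 (B1 - {b1}) \<in> indep (?\<Psi> r)"
    if B: "B1 \<in> bases (?\<Psi> r)" "B2 \<in> bases (?\<Psi> r)" "b1 \<in> B1 - B2" for B1 B2 b1
  proof -
    have sub: "B1 \<subseteq> X" "B2 \<subseteq> X"
      using indep_ground[OF QE_complex[OF \<Psi>] bases_indep] B(1,2) by auto
    then have "b1 \<in> X"
      using B(3) by blast
    then obtain r' where r': "linear_order_on X r'" "\<And>x. x \<in> X \<Longrightarrow> (x, b1) \<in> r'"
      using linear_order_with_max by metis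
    have "less_in (?\<Psi> r') x b1" if "x \<in> B2 - B1" for x
      using that r'(2) sub B(3) unfolding less_in_def by auto
    then obtain b2 where "b2 \<in> B2 - B1" "insert b2 (B1 - {b1}) \<in> indep (?\<Psi> r')"
      using QE_exchange[OF all[OF r'(1)]] B unfolding bases[of r r'] by metis
    then show ?thesis by auto
  qed
  then show ?thesis
    using basis_exchange_matroid[OF QE_complex[OF \<Psi>] QE_pure[OF \<Psi>]] by simp
qed

section \<open>Quasi-matroidality and the inclusion in \<open>PURE\<close>\<close>

lemma quasi_matroidal_QE: "quasi_matroidal QE"
  unfolding quasi_matroidal_def
proof (intro conjI allI ballI impI; (elim conjE)?)
  fix \<Psi> :: "'a ocomplex" and e
  assume "\<Psi> \<in> QE" "is_max \<Psi> (ground \<Psi>) e" "e \<notin> coloops \<Psi>"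
  then show "deletion \<Psi> e \<in> QE"
    using QE_deletion(1)[of \<Psi> "ground \<Psi>" e] unfolding is_max_def vertices_def by blast
qed (auto intro: QE_complex ordered_matroid_QE QE_all_orders_matroid shifted_QE QE_join QE_contraction)

text \<open>Induction on the size of the ground set: deletions and contractions by nonempty sets
  stay in \<open>QE\<close> and lose at least one element.\<close>

lemma QE_PURE: "\<Psi> \<in> QE \<Longrightarrow> \<Psi> \<in> PURE"
proof (induction "card (ground \<Psi>)" arbitrary: \<Psi> rule: less_induct)
  case less
  note \<Psi> = less.prems
  note oc = QE_complex[OF \<Psi>] and p = QE_pure[OF \<Psi>]
  have smaller: "\<Phi> \<in> PURE" if "\<Phi> \<in> QE" "ground \<Phi> \<subset> ground \<Psi>" for \<Phi>
    using less.hyps that psubset_card_mono[OF finite_ground[OF oc]] by blast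
  show ?case
  proof (cases "\<exists>!B. B \<in> bases \<Psi>")
    case True
    with oc p show ?thesis by (rule PURE.unique_basis)
  next
    case False
    then obtain B B' where B: "B \<in> bases \<Psi>" "B' \<in> bases \<Psi>" "B \<noteq> B'"
      using bases_nonempty[OF oc] by blast
    \<comment> \<open>Distinct bases are not nested, so some \<open>x\<close> lies in only one of
      the two. It is a non-coloop vertex, which makes the largest such vertex \<open>v\<close>
      exist.\<close>
    then obtain x where x: "x \<in> B - B'"
      using bases_maximal[OF B(1) bases_indep[OF B(2)]] by blast
    then have "x \<in> vertices \<Psi> - coloops \<Psi>"
      using B indep_ground[OF oc bases_indep[OF B(1)]]
      unfolding vertices_def loops_def coloops_def by blast
    moreover have "vertices \<Psi> - coloops \<Psi> \<subseteq> ground \<Psi>"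
      unfolding vertices_def by blast
    ultimately obtain v where v: "is_max \<Psi> (vertices \<Psi> - coloops \<Psi>) v"
      using max_exists[OF oc] finite_subset[OF _ finite_ground[OF oc]] by (metis empty_iff)
    then have v': "v \<in> ground \<Psi>" "v \<notin> coloops \<Psi>"
      unfolding is_max_def vertices_def by blast+
    \<comment> \<open>Here \<open>S\<close> is the set of non-coloop vertices itself; the second
      fact in \<open>del\<close> is the rank condition of the recursion.\<close>
    note del = QE_deletion[OF \<Psi> v v' subset_refl]
    show ?thesis
    proof (rule PURE.deletion_contraction[OF oc p v _ del(2)])
      show "deletion \<Psi> v \<in> PURE"
        using smaller[OF del(1)] v'(1) unfolding deletion_def by auto
      show "contraction \<Psi> I \<in> PURE" if "I \<in> indep \<Psi>" "I \<noteq> {}" for I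
        using smaller[OF QE_contraction[OF \<Psi> that(1)]] that(2) indep_ground[OF oc that(1)] by auto
    qed
  qed
qed

theorem theorem4p7:
  shows "(\<forall>(\<Psi> :: 'a ocomplex) (\<Psi>' :: 'b ocomplex) B0.
            \<Psi> \<in> QE \<and> \<Psi>' \<in> QE \<and> lex_smallest_basis \<Psi> B0 \<longrightarrow>
              (\<forall>(S :: 'c set) s j j'.
                 is_shuffle (ground \<Psi>) (ord \<Psi>) (ground \<Psi>') (ord \<Psi>') S s j j' \<longrightarrow>
                 join S s j j' \<Psi> \<Psi>' \<in> QE) \<and>
              (\<forall>U. U \<subseteq> ground \<Psi> \<and> pure (restriction \<Psi> U) \<and>
                   complex_rank (restriction \<Psi> U) = complex_rank \<Psi> \<longrightarrow>
                 restriction \<Psi> U \<in> QE) \<and>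
              (\<forall>A. A \<subseteq> ground \<Psi> \<and> B0 \<subseteq> A \<and>
                   (\<forall>m. is_max \<Psi> (B0 - coloops \<Psi>) m \<longrightarrow>
                        {e \<in> ground \<Psi>. less_in \<Psi> e m} \<subseteq> A) \<longrightarrow>
                 restriction \<Psi> A \<in> QE) \<and>
              (\<forall>v\<in>vertices \<Psi>. contraction \<Psi> {v} \<in> QE)) \<and>
         quasi_matroidal (QE :: 'a ocomplex set) \<and>
         (QE :: 'a ocomplex set) \<subseteq> PURE"
proof (intro conjI allI impI ballI; (elim conjE)?)
  fix \<Psi> :: "'a ocomplex" and B0 A
  assume "\<Psi> \<in> QE" "lex_smallest_basis \<Psi> B0" "A \<subseteq> ground \<Psi>" "B0 \<subseteq> A"
    "\<forall>m. is_max \<Psi> (B0 - coloops \<Psi>) m \<longrightarrow> {e \<in> ground \<Psi>. less_in \<Psi> e m} \<subseteq> A"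
  then show "restriction \<Psi> A \<in> QE"
    using QE_restriction_initial[of \<Psi> A B0] unfolding lex_smallest_basis_def by blast
next
  show "quasi_matroidal (QE :: 'a ocomplex set)"
    by (rule quasi_matroidal_QE)
  show "(QE :: 'a ocomplex set) \<subseteq> PURE"
    using QE_PURE by blast
qed (blast intro: QE_join QE_restriction_full_rank QE_contraction vertex_indep QE_complex)+

end
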